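(* Let $0<\nu\le 1$. If $f\in\mathcal{G}(\nu)$ with $f(z)=z+\sum_{n=2}^\infty a_nz^n$, then $$|H_{2,1}(F_f/2)|\le \frac{\nu^2(\nu^2+12\nu-44)}{192(\nu^2+8\nu-32)}.$$ The inequality is sharp, i.e., for each $\nu\in(0,1]$ there is a function $f\in\mathcal{G}(\nu)$ for which equality holds.
   Context: Let $\mathbb{D}=\{z\in\mathbb{C}:|z|<1\}$ and let $\mathcal{A}$ be the class of analytic functions $f$ on $\mathbb{D}$ of the form $f(z)=z+\sum_{n=2}^\infty a_nz^n$. Let $\mathcal{LU}=\{f\in\mathcal{A}: f'(z)\neq 0 \text{ for all } z\in\mathbb{D}\}$. For $\nu>0$, $$\mathcal{G}(\nu)=\Big\{f\in\mathcal{LU}:\ \mathrm{Re}\Big(1+\frac{zf''(z)}{f'(z)}\Big)<1+\frac{\nu}{2}\ \text{ for } z\in\mathbb{D}\Big\}.$$ The logarithmic coefficients $\gamma_n=\gamma_n(f)$ are defined by $F_f(z)=\log\frac{f(z)}{z}=2\sum_{n=1}^\infty\gamma_nz^n$ (branch with value $0$ at $z=0$), and the second Hankel determinant of the logarithmic coefficients is $$H_{2,1}(F_f/2)=\gamma_1\gamma_3-\gamma_2^2=\frac14\Big(a_2a_4-a_3^2+\frac1{12}a_2^4\Big).$$ *)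

theory Defs
  imports "HOL-Complex_Analysis.Complex_Analysis"
begin

text \<open>The open unit disk is \<^term>\<open>ball (0::complex) 1\<close>. A function on the disk is a total
  function on \<^typ>\<open>complex\<close> whose values outside the disk are irrelevant.\<close>

definition class_A :: "(complex \<Rightarrow> complex) set" where
  "class_A = {f. f holomorphic_on ball 0 1 \<and>
     (\<exists>a :: nat \<Rightarrow> complex. \<forall>z\<in>ball 0 1. (\<lambda>n. a (n + 2) * z ^ (n + 2)) sums (f z - z))}"

definition class_LU :: "(complex \<Rightarrow> complex) set" where
  "class_LU = {f \<in> class_A. \<forall>z\<in>ball 0 1. deriv f z \<noteq> 0}"

definition class_G :: "real \<Rightarrow> (complex \<Rightarrow> complex) set" where
  "class_G \<nu> = {f \<in> class_LU. \<forall>z\<in>ball 0 1.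
     Re (1 + z * deriv (deriv f) z / deriv f z) < 1 + \<nu> / 2}"

text \<open>The principal logarithm represents the branch of \<open>log (f z / z)\<close> vanishing at \<open>0\<close> only on
  a neighbourhood of \<open>0\<close>, which is all that its Taylor coefficients at \<open>0\<close> depend on; by
  \<open>log_coeff_eq_branch\<close> below, any holomorphic branch gives the same coefficients.\<close>

definition log_quot :: "(complex \<Rightarrow> complex) \<Rightarrow> complex \<Rightarrow> complex" where
  "log_quot f z = (if z = 0 then 0 else Ln (f z / z))"

definition log_coeff :: "(complex \<Rightarrow> complex) \<Rightarrow> nat \<Rightarrow> complex" where
  "log_coeff f n = fps_nth (fps_expansion (log_quot f) 0) n / 2"

definition hankel_log_2_1 :: "(complex \<Rightarrow> complex) \<Rightarrow> complex" where
  "hankel_log_2_1 f = log_coeff f 1 * log_coeff f 3 - (log_coeff f 2)\<^sup>2"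

lemma class_A_iff:
  "f \<in> class_A \<longleftrightarrow> f holomorphic_on ball 0 1 \<and> f 0 = 0 \<and> deriv f 0 = 1"
proof
  assume f: "f \<in> class_A"
  then obtain a where a: "\<And>z. z \<in> ball 0 1 \<Longrightarrow> (\<lambda>n. a (n + 2) * z ^ (n + 2)) sums (f z - z)"
    and holf: "f holomorphic_on ball 0 1"
    unfolding class_A_def by blast
  define b where "b = (\<lambda>n. if n = 0 then 0 else if n = 1 then 1 else a n)"
  have b: "(\<lambda>n. b n * z ^ n) sums f z" if "z \<in> ball 0 1" for z
  proof -
    have "(\<lambda>n. b (n + 2) * z ^ (n + 2)) sums (f z - z)"
      using a[OF that] by (simp add: b_def)
    then have "(\<lambda>n. b n * z ^ n) sums (f z - z + (\<Sum>i<2. b i * z ^ i))"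
      by (subst (asm) sums_iff_shift)
    then show ?thesis
      by (simp add: b_def eval_nat_numeral)
  qed
  have "(\<lambda>n. b n * z ^ n) sums f z" if "norm z < 1" for z
    using b that by simp
  moreover have "(f has_field_derivative deriv f 0) (at 0)"
    using holf by (intro holomorphic_derivI[of f "ball 0 1"]) auto
  ultimately have "(\<lambda>n. diffs b n * 0 ^ n) sums deriv f 0"
    by (rule termdiffs_sums_strong[where K = 1]) auto
  then have "deriv f 0 = diffs b 0"
    by (simp add: sums_iff)
  moreover have "f 0 = 0"
    using a[of 0] by (simp add: sums_iff)
  ultimately show "f holomorphic_on ball 0 1 \<and> f 0 = 0 \<and> deriv f 0 = 1"
    using holf by (simp add: diffs_def b_def)
next
  assume f: "f holomorphic_on ball 0 1 \<and> f 0 = 0 \<and> deriv f 0 = 1"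
  define a where "a = (\<lambda>n. (deriv ^^ n) f 0 / fact n)"
  have "(\<lambda>n. a (n + 2) * z ^ (n + 2)) sums (f z - z)" if z: "z \<in> ball 0 1" for z
  proof -
    have "(\<lambda>n. a n * z ^ n) sums f z"
      using holomorphic_power_series[of f 0 1 z] f z by (simp add: a_def)
    then have "(\<lambda>n. a (n + 2) * z ^ (n + 2)) sums (f z - (\<Sum>i<2. a i * z ^ i))"
      by (rule sums_split_initial_segment)
    then show ?thesis
      using f by (simp add: a_def eval_nat_numeral)
  qed
  then show "f \<in> class_A"
    using f unfolding class_A_def by blast
qed

lemma log_coeff_eq_branch:
  assumes "r > 0" "F holomorphic_on ball 0 r" "F 0 = 0"
    and exp_F: "\<And>z. z \<in> ball 0 r - {0} \<Longrightarrow> exp (F z) = f z / z"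
  shows "log_coeff f n = fps_nth (fps_expansion F 0) n / 2"
proof -
  have "isCont F 0"
    using assms by (metis centre_in_ball continuous_on_interior holomorphic_on_imp_continuous_on
        interior_open open_ball)
  then have "(F \<longlongrightarrow> 0) (nhds 0)"
    using assms(3) by (metis isCont_def tendsto_at_iff_tendsto_nhds)
  then have small: "\<forall>\<^sub>F z in nhds 0. norm (F z) < pi"
    using order_tendstoD(2)[OF tendsto_norm_zero, of F "nhds 0" pi] by simp
  have "\<forall>\<^sub>F z in nhds 0. z \<in> ball 0 r"
    using assms(1) by (intro eventually_nhds_in_open) auto
  with small have "\<forall>\<^sub>F z in nhds 0. log_quot f z = F z"
  proof eventually_elim
    case (elim z)
    have "\<bar>Im (F z)\<bar> < pi"
      using elim abs_Im_le_cmod[of "F z"] by linarith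
    then show ?case
      using elim exp_F[of z] assms(3) by (auto simp: log_quot_def simp flip: exp_F)
  qed
  then show ?thesis
    unfolding log_coeff_def fps_expansion_def by (simp add: higher_deriv_cong_ev)
qed

lemma log_quot_sums:
  assumes "f \<in> class_A"
  shows "\<forall>\<^sub>F z in nhds 0. (\<lambda>n. 2 * log_coeff f n * z ^ n) sums log_quot f z"
proof -
  have f: "f holomorphic_on ball 0 1" "f 0 = 0" "deriv f 0 = 1"
    using assms by (auto simp: class_A_iff)
  define g where "g = (\<lambda>z. if z = 0 then deriv f 0 else f z / z)"
  have holg: "g holomorphic_on ball 0 1"
    using pole_theorem_open_0[OF f(1), of 0 g] f(2) by (simp add: g_def)
  then have "isCont g 0"
    by (metis centre_in_ball continuous_on_interior holomorphic_on_imp_continuous_on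
        interior_open open_ball zero_less_one)
  moreover have "g 0 = 1"
    using f(3) by (simp add: g_def)
  ultimately have "(g \<longlongrightarrow> 1) (nhds 0)"
    by (metis isCont_def tendsto_at_iff_tendsto_nhds)
  then have "\<forall>\<^sub>F z in nhds 0. g z \<in> ball 1 1"
    by (rule topological_tendstoD) auto
  then obtain e where e: "e > 0" "\<And>z. z \<in> ball 0 e \<Longrightarrow> g z \<in> ball 1 1"
    by (auto simp: eventually_nhds_metric dist_commute)
  define r where "r = min e 1"
  have nonpos: "g z \<notin> \<real>\<^sub>\<le>\<^sub>0" if "z \<in> ball 0 r" for z
  proof
    assume "g z \<in> \<real>\<^sub>\<le>\<^sub>0"
    then have "Re (g z) \<le> 0" by (auto elim: nonpos_Reals_cases)
    moreover have "\<bar>Re (1 - g z)\<bar> < 1"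
      using e(2)[of z] that abs_Re_le_cmod[of "1 - g z"] by (auto simp: r_def dist_norm)
    ultimately show False by simp
  qed
  have "(\<lambda>z. Ln (g z)) holomorphic_on ball 0 r"
    using nonpos holg by (intro holomorphic_intros) (auto simp: r_def elim: holomorphic_on_subset)
  moreover have "Ln (g z) = log_quot f z" for z
    using f(3) by (simp add: g_def log_quot_def)
  ultimately have hol: "log_quot f holomorphic_on ball 0 r"
    by simp
  have "(\<lambda>n. 2 * log_coeff f n * z ^ n) sums log_quot f z" if "z \<in> ball 0 r" for z
    using holomorphic_power_series[OF hol that] by (simp add: log_coeff_def fps_expansion_def)
  moreover have "\<forall>\<^sub>F z in nhds 0. z \<in> ball 0 r"
    using e(1) by (intro eventually_nhds_in_open) (auto simp: r_def)
  ultimately show ?thesis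
    by (auto elim: eventually_mono)
qed

end

theory Submission
  imports Defs
begin

text \<open>A function \<open>f\<close> lies in \<open>class_G \<nu>\<close> iff \<open>f'' (1 - z \<phi>) = -\<nu> \<phi> f'\<close> for some holomorphic \<open>\<phi>\<close>
  bounded by 1 on the disk. Comparing coefficients turns the Hankel determinant into a polynomial
  in the first three coefficients of \<open>\<phi>\<close>, which two steps of the Schur algorithm parametrise by
  \<open>b, x, y\<close> in the closed unit disk. The triangle inequality removes \<open>y\<close> and leaves the maximum
  of \<open>C (1 - |x|\<^sup>2) + |A + B x - C x\<^sup>2|\<close>, where \<open>A, B, C \<ge> 0\<close> depend on \<open>t = |b|\<^sup>2\<close> only. When it
  exceeds 16 it is at most \<open>C + B - A\<close>, the value at \<open>x = -1\<close>: a concave quadratic in \<open>t\<close>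
  maximal at \<open>t = (4 - 2\<nu>) / (32 - 8\<nu> - \<nu>\<^sup>2)\<close>. There \<open>|x| = 1\<close>, so the extremal \<open>\<phi>\<close> is the disk
  automorphism \<open>(c - z) / (1 - c z)\<close> with \<open>c = \<surd>t\<close>.\<close>

section \<open>An extremal problem on the disk\<close>

text \<open>For \<open>norm x = 1\<close> and \<open>m = - Re x\<close> the left side is the squared
  modulus of \<open>A + B * x - C * x\<^sup>2\<close>. It is concave in \<open>m\<close>: if the
  vertex is not below \<open>m = 1\<close>, the value there, \<open>(C + B - A)\<^sup>2\<close>,
  dominates; otherwise \<open>2 * m \<le> 1 + m\<^sup>2\<close> and
  \<open>B * (C - A) < 4 * A * C\<close> reduce it to \<open>T2\<close>.\<close>

lemma quadratic_bound_circle: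
  fixes A B C T m :: real
  assumes "0 \<le> A" "0 \<le> B" "A \<le> C" "C + B - A \<le> T"
    and T2: "(A + C)\<^sup>2 + B\<^sup>2 + B * (C - A) \<le> T\<^sup>2" and m: "\<bar>m\<bar> \<le> 1"
  shows "(A + C)\<^sup>2 + B\<^sup>2 + 2 * B * m * (C - A) - 4 * A * C * m\<^sup>2 \<le> T\<^sup>2"
proof (cases "4 * A * C \<le> B * (C - A)")
  case True
  have "4 * A * C * (1 - m\<^sup>2) \<le> 4 * A * C * (2 * (1 - m))"
  proof (rule mult_left_mono)
    have "0 \<le> (1 - m)\<^sup>2" by simp
    then show "1 - m\<^sup>2 \<le> 2 * (1 - m)" by (simp add: power2_diff)
  qed (use assms in auto)
  also have "\<dots> \<le> B * (C - A) * (2 * (1 - m))"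
    using True m by (intro mult_right_mono) auto
  finally have "(A + C)\<^sup>2 + B\<^sup>2 + 2 * B * m * (C - A) - 4 * A * C * m\<^sup>2 \<le> (C + B - A)\<^sup>2"
    by (simp add: algebra_simps power2_eq_square)
  also have "\<dots> \<le> T\<^sup>2"
    using assms by (intro power_mono) auto
  finally show ?thesis .
next
  case False
  then have "B * (C - A) * m\<^sup>2 \<le> 4 * A * C * m\<^sup>2"
    by (intro mult_right_mono) auto
  moreover have "0 \<le> B * (C - A) * (1 - m)\<^sup>2"
    using assms by simp
  ultimately show ?thesis
    using T2 by (simp add: algebra_simps power2_eq_square)
qed

text \<open>For fixed \<open>Re x\<close> the squared inequality is affine in
  \<open>(norm x)\<^sup>2\<close>, so it suffices to check the unit circle and the real diameter.
  \<open>T2\<close> serves the circle, \<open>disc\<close> the diameter.\<close>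

lemma quadratic_bound_disc:
  fixes A B C T :: real and x :: complex
  assumes "0 \<le> A" "0 \<le> B" "A \<le> C" "C + B - A \<le> T" "A + C \<le> T"
    and T2: "(A + C)\<^sup>2 + B\<^sup>2 + B * (C - A) \<le> T\<^sup>2"
    and disc: "B\<^sup>2 \<le> 8 * C * (T - C - A)" and x: "norm x \<le> 1"
  shows "C * (1 - (norm x)\<^sup>2) + norm (A + B * x - C * x\<^sup>2) \<le> T"
proof -
  \<comment> \<open>The sign of \<open>m\<close> puts the critical point \<open>x = -1\<close> at
    \<open>m = 1\<close>. With \<open>D\<close> the claim reads
    \<open>norm (A + B * x - C * x\<^sup>2) \<le> D + C * v\<close>.\<close>
  define m n D v where "m = - Re x" and "n = Im x" and "D = T - C" and "v = m\<^sup>2 + n\<^sup>2"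
  have v: "(norm x)\<^sup>2 = v"
    by (simp add: cmod_power2 v_def m_def n_def)
  have "v \<le> 1"
    using x unfolding v[symmetric] by (simp add: power_le_one)
  have mv: "m\<^sup>2 \<le> v" by (simp add: v_def)
  have m1: "\<bar>m\<bar> \<le> 1"
    using x abs_Re_le_cmod[of x] by (simp add: m_def)
  \<comment> \<open>Difference of the squares of both sides of that inequality with \<open>v\<close>
    replaced by \<open>w\<close>. The \<open>w\<^sup>2\<close> terms cancel; \<open>w = 1\<close> is
    the circle and \<open>w = m\<^sup>2\<close> the real point \<open>x = - m\<close>.\<close>
  define G where "G = (\<lambda>w. (D + C * w)\<^sup>2
      - (B\<^sup>2 * w + (A + C * w)\<^sup>2 - 2 * B * m * (A - C * w) - 4 * A * C * m\<^sup>2))"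
  have norm2: "(norm (A + B * x - C * x\<^sup>2))\<^sup>2
      = B\<^sup>2 * v + (A + C * v)\<^sup>2 - 2 * B * m * (A - C * v) - 4 * A * C * m\<^sup>2"
    unfolding cmod_power2 v_def m_def n_def
    by (simp add: Re_power2 Im_power2 algebra_simps power2_eq_square)
  have G1: "0 \<le> G 1"
    using quadratic_bound_circle[OF assms(1-4) T2 m1]
    by (simp add: G_def D_def algebra_simps power2_eq_square)
  \<comment> \<open>At a real point \<open>G (m\<^sup>2)\<close> factors as a difference of squares.
    This factor is a quadratic in \<open>m\<close> with nonpositive discriminant by
    \<open>disc\<close>; the other one is linear in \<open>m\<close>.\<close>
  have "0 \<le> D - A + B * m + 2 * C * m\<^sup>2"
  proof (cases "C = 0")
    case True
    then have "B = 0" using disc by simp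
    then show ?thesis using True assms by (simp add: D_def)
  next
    case False
    then have "0 < C" using assms by simp
    have "0 \<le> (B + 4 * C * m)\<^sup>2 + (8 * C * (T - C - A) - B\<^sup>2)"
      using disc by (intro add_nonneg_nonneg) auto
    also have "\<dots> = 8 * C * (D - A + B * m + 2 * C * m\<^sup>2)"
      by (simp add: D_def algebra_simps power2_eq_square)
    finally show ?thesis using \<open>0 < C\<close> by (simp add: zero_le_mult_iff)
  qed
  moreover have "0 \<le> D + A - B * m"
  proof -
    have "B * m \<le> B * 1" using m1 assms by (intro mult_left_mono) auto
    then show ?thesis using assms by (simp add: D_def)
  qed
  ultimately have "0 \<le> (D - A + B * m + 2 * C * m\<^sup>2) * (D + A - B * m)"
    by simp
  then have Gm: "0 \<le> G (m\<^sup>2)"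
    by (simp add: G_def algebra_simps power2_eq_square)
  txt \<open>For fixed \<open>m\<close> the defect \<open>G\<close> is affine in \<open>v\<close>.\<close>
  have "(1 - m\<^sup>2) * G v = (v - m\<^sup>2) * G 1 + (1 - v) * G (m\<^sup>2)"
    by (simp add: G_def algebra_simps power2_eq_square)
  moreover have "0 \<le> (v - m\<^sup>2) * G 1 + (1 - v) * G (m\<^sup>2)"
    using G1 Gm mv \<open>v \<le> 1\<close> by (intro add_nonneg_nonneg mult_nonneg_nonneg) auto
  ultimately have "0 \<le> (1 - m\<^sup>2) * G v" by simp
  \<comment> \<open>If \<open>m\<^sup>2 = 1\<close>, then \<open>v = 1\<close> and
    \<open>G 1\<close> settles it; otherwise the positive factor cancels.\<close>
  then have "0 \<le> G v"
    using G1 mv \<open>v \<le> 1\<close> by (cases "m\<^sup>2 = 1") (auto simp: zero_le_mult_iff)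
  then have "(norm (A + B * x - C * x\<^sup>2))\<^sup>2 \<le> (D + C * v)\<^sup>2"
    unfolding norm2 by (simp add: G_def)
  moreover have "0 \<le> D + C * v"
    using assms mv by (auto simp: D_def v_def)
  ultimately have "norm (A + B * x - C * x\<^sup>2) \<le> D + C * v"
    by (rule power2_le_imp_le)
  then show ?thesis
    unfolding v by (simp add: D_def algebra_simps)
qed

text \<open>\<open>b1\<close> and \<open>b2\<close> are the Schur parametrisation of the
  coefficients following \<open>b\<close>. For \<open>t > 1 / 2\<close> the plain triangle
  inequality already gives 16, which is below the bound; for \<open>t \<le> 1 / 2\<close> one has
  \<open>A \<le> C\<close> and \<open>quadratic_bound_disc\<close> applies.\<close>

lemma hankel_functional_bound:
  fixes \<nu> :: real and b x y :: complex
  assumes \<nu>: "0 < \<nu>" "\<nu> \<le> 1" and b: "norm b \<le> 1" and x: "norm x \<le> 1" and y: "norm y \<le> 1"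
  defines "b1 \<equiv> (1 - (norm b)\<^sup>2) * x"
    and "b2 \<equiv> (1 - (norm b)\<^sup>2) * ((1 - (norm x)\<^sup>2) * y - cnj b * x\<^sup>2)"
  shows "norm (24 * b * b2 - 16 * b1\<^sup>2 + (16 - 4 * \<nu>) * b\<^sup>2 * b1 + (8 - 4 * \<nu> - \<nu>\<^sup>2) * b ^ 4)
    \<le> 12 * (44 - 12 * \<nu> - \<nu>\<^sup>2) / (32 - 8 * \<nu> - \<nu>\<^sup>2)" (is "norm ?E \<le> ?T")
proof -
  define s t u where "s = norm b" and "t = s\<^sup>2" and "u = norm x"
  define \<alpha> K where "\<alpha> = 8 - 4 * \<nu> - \<nu>\<^sup>2" and "K = 32 - 8 * \<nu> - \<nu>\<^sup>2"
  define A B C where "A = \<alpha> * t\<^sup>2" and "B = (16 - 4 * \<nu>) * (1 - t) * t"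
    and "C = (1 - t) * (16 + 8 * t)"
  have s: "0 \<le> s" "s \<le> 1" using b by (auto simp: s_def)
  have t: "0 \<le> t" "t \<le> 1" using s by (auto simp: t_def power_le_one)
  have u: "0 \<le> u" "u\<^sup>2 \<le> 1" using x by (auto simp: u_def power_le_one)
  have "0 \<le> \<nu>\<^sup>2" "\<nu>\<^sup>2 \<le> 1" using \<nu> by (auto simp: power_le_one)
  then have \<alpha>: "0 \<le> \<alpha>" "\<alpha> \<le> 8" and K: "0 < K"
    unfolding \<alpha>_def K_def using \<nu> by linarith+
  \<comment> \<open>This form shows \<open>16 \<le> ?T\<close> and is the one met when completing
    the square in \<open>t\<close>.\<close>
  have T: "?T = 16 + (4 - 2 * \<nu>)\<^sup>2 / K"
    using K by (simp add: K_def field_simps power2_eq_square)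
  then have T16: "16 \<le> ?T" using K by simp
  have A: "0 \<le> A" "A \<le> 8 * t\<^sup>2"
    using \<alpha> by (auto simp: A_def intro: mult_right_mono)
  have t1: "0 \<le> (1 - t) * t" using t by simp
  have B: "0 \<le> B" "B \<le> 16 * ((1 - t) * t)"
  proof -
    show "0 \<le> B" unfolding B_def using \<nu> t by (intro mult_nonneg_nonneg) auto
    show "B \<le> 16 * ((1 - t) * t)"
      unfolding B_def mult.assoc using \<nu> t1 by (intro mult_right_mono) auto
  qed
  have C: "0 \<le> C" using t by (simp add: C_def)
  have sq: "complex_of_real ((norm z)\<^sup>2) = z * cnj z" for z
    by (simp add: complex_norm_square flip: of_real_power)
  \<comment> \<open>The phase of \<open>b\<close>. Rotating \<open>x\<close> by
    \<open>(cnj e)\<^sup>2\<close> lets \<open>b ^ 4\<close>, \<open>b\<^sup>2 * x\<close> and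
    \<open>x\<^sup>2\<close> all carry the same factor \<open>e ^ 4\<close>, so the coefficients
    become real.\<close>
  obtain e where e: "norm e = 1" "b = of_real s * e"
  proof (cases "b = 0")
    case True
    then show ?thesis by (intro that[of 1]) (auto simp: s_def)
  next
    case False
    then show ?thesis
      by (intro that[of "sgn b"]) (auto simp: s_def sgn_eq norm_divide)
  qed
  define x' where "x' = x * (cnj e)\<^sup>2"
  have ee: "e * cnj e = 1"
    using e(1) sq[of e] by simp
  have x': "norm x' = u" "x = x' * e\<^sup>2"
  proof -
    show "norm x' = u" using e(1) by (simp add: x'_def u_def norm_mult norm_power)
    have "x' * e\<^sup>2 = x * (e * cnj e)\<^sup>2" by (simp add: x'_def power_mult_distrib)
    then show "x = x' * e\<^sup>2" by (simp add: ee)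
  qed
  \<comment> \<open>\<open>C\<close> collects the \<open>x\<^sup>2\<close> terms of both
    \<open>b1\<^sup>2\<close> and \<open>b * b2\<close>:
    \<open>16 * (1 - t)\<^sup>2 + 24 * t * (1 - t)\<close>.\<close>
  have E: "?E = of_real (24 * (1 - t) * (1 - u\<^sup>2)) * (b * y) + e ^ 4 * (A + B * x' - C * x'\<^sup>2)"
  proof -
    have "b * cnj b = of_real t" by (simp add: t_def s_def flip: sq)
    then have "?E = of_real (24 * (1 - t) * (1 - u\<^sup>2)) * (b * y)
        + (\<alpha> * b ^ 4 + (16 - 4 * \<nu>) * (1 - t) * b\<^sup>2 * x - C * x\<^sup>2)"
      unfolding b1_def b2_def C_def \<alpha>_def u_def t_def s_def by simp algebra
    also have "\<alpha> * b ^ 4 + (16 - 4 * \<nu>) * (1 - t) * b\<^sup>2 * x - C * x\<^sup>2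
        = e ^ 4 * (A + B * x' - C * x'\<^sup>2)"
      unfolding A_def B_def e(2) x'(2) by (simp add: t_def) algebra
    finally show ?thesis .
  qed
  have "24 * (1 - t) * (1 - u\<^sup>2) * norm (b * y) \<le> C * (1 - u\<^sup>2)"
  proof -
    have "norm (b * y) \<le> s"
      using y s by (simp add: norm_mult s_def mult_left_le)
    \<comment> \<open>This replaces the weight of \<open>y\<close> by \<open>C\<close>. The loss is
      harmless for sharpness, since the weight carries \<open>1 - u\<^sup>2\<close>, which vanishes
      at the extremal point.\<close>
    moreover have "24 * s \<le> 16 + 8 * t"
    proof -
      have "0 \<le> 8 * ((1 - s) * (2 - s))" using s by simp
      then show ?thesis by (simp add: t_def algebra_simps power2_eq_square)
    qed
    ultimately have "24 * norm (b * y) \<le> 16 + 8 * t" by linarith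
    then have "((1 - t) * (1 - u\<^sup>2)) * (24 * norm (b * y)) \<le> ((1 - t) * (1 - u\<^sup>2)) * (16 + 8 * t)"
      using t u by (intro mult_left_mono) auto
    then show ?thesis by (simp add: C_def algebra_simps)
  qed
  moreover have "norm ?E \<le> 24 * (1 - t) * (1 - u\<^sup>2) * norm (b * y) + norm (A + B * x' - C * x'\<^sup>2)"
  proof -
    have "norm ?E \<le> norm (of_real (24 * (1 - t) * (1 - u\<^sup>2)) * (b * y))
        + norm (e ^ 4 * (A + B * x' - C * x'\<^sup>2))"
      unfolding E by (rule norm_triangle_ineq)
    also have "norm (of_real (24 * (1 - t) * (1 - u\<^sup>2)) * (b * y)) = 24 * (1 - t) * (1 - u\<^sup>2) * norm (b * y)"
      using t u by (subst norm_mult, subst norm_of_real) (simp add: abs_mult)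
    also have "norm (e ^ 4 * (A + B * x' - C * x'\<^sup>2)) = norm (A + B * x' - C * x'\<^sup>2)"
      by (simp add: norm_mult norm_power e)
    finally show ?thesis .
  qed
  moreover have "C * (1 - u\<^sup>2) + norm (A + B * x' - C * x'\<^sup>2) \<le> ?T"
  proof (cases "t \<le> 1 / 2")
    case False
    have "norm (A + B * x' - C * x'\<^sup>2) \<le> norm (complex_of_real A) + norm (B * x') + norm (C * x'\<^sup>2)"
      by (meson norm_triangle_ineq norm_triangle_ineq4 add_right_mono order_trans)
    also have "\<dots> = A + B * u + C * u\<^sup>2"
      using A B C by (simp add: norm_mult norm_power x')
    also have "B * u \<le> B"
      using B x by (simp add: u_def mult_left_le)
    finally have "C * (1 - u\<^sup>2) + norm (A + B * x' - C * x'\<^sup>2) \<le> A + B + C"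
      by (simp add: algebra_simps)
    also have "\<dots> \<le> 8 * t\<^sup>2 + 16 * ((1 - t) * t) + C"
      using A B by simp
    also have "\<dots> = 16 - 8 * t * (2 * t - 1)"
      by (simp add: C_def algebra_simps power2_eq_square)
    also have "\<dots> \<le> 16" using False by simp
    finally show ?thesis using T16 by linarith
  next
    case True
    have tt: "t\<^sup>2 \<le> t / 2"
      using mult_left_mono[OF True t(1)] by (simp add: power2_eq_square)
    have C': "C = 16 - 8 * t - 8 * t\<^sup>2"
      by (simp add: C_def algebra_simps power2_eq_square)
    have AC: "A + C \<le> 16 - 8 * t" using A C' by simp
    have le: "A \<le> C" using A(2) C' tt True by linarith
    \<comment> \<open>Completing the square in \<open>t\<close> produces \<open>?T\<close>; the
      square vanishes at \<open>t = (4 - 2 * \<nu>) / K\<close>.\<close>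
    have "C + B - A = 16 + 2 * (4 - 2 * \<nu>) * t - K * t\<^sup>2"
      by (simp add: A_def B_def C_def K_def \<alpha>_def algebra_simps power2_eq_square)
    also have "\<dots> = ?T - (K * t - (4 - 2 * \<nu>))\<^sup>2 / K"
      unfolding T using K by (simp add: field_simps power2_eq_square)
    also have "\<dots> \<le> ?T" using K by simp
    finally have end1: "C + B - A \<le> ?T" .
    \<comment> \<open>Majorants free of \<open>\<nu>\<close> suffice here and for
      \<open>disc\<close>, because these conditions only need \<open>16 \<le> ?T\<close>.\<close>
    have "(A + C)\<^sup>2 + B\<^sup>2 + B * (C - A)
        \<le> (16 - 8 * t)\<^sup>2 + (16 * ((1 - t) * t))\<^sup>2 + 16 * ((1 - t) * t) * C"
      using A(1) B C t1 AC le by (intro add_mono power_mono mult_mono) auto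
    also have "\<dots> = 256 - 64 * t\<^sup>2 * (1 + 2 * t * (4 - 3 * t))"
      unfolding C_def by algebra
    also have "\<dots> \<le> 256" using t by simp
    also have "\<dots> \<le> ?T\<^sup>2" using power_mono[OF T16, of 2] by simp
    finally have mid: "(A + C)\<^sup>2 + B\<^sup>2 + B * (C - A) \<le> ?T\<^sup>2" .
    have "B\<^sup>2 \<le> (16 * ((1 - t) * t))\<^sup>2"
      using B by (intro power_mono) auto
    also have "\<dots> = 256 * t * (1 - t) * ((1 - t) * t)"
      by (simp add: power2_eq_square)
    also have "\<dots> \<le> 256 * t * (1 - t) * (4 + 2 * t)"
    proof (rule mult_left_mono)
      have "(1 - t) * t \<le> 1 * 1" using t by (intro mult_mono) auto
      then show "(1 - t) * t \<le> 4 + 2 * t" using t by simp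
    qed (use t in auto)
    also have "\<dots> = 8 * C * (8 * t)"
      unfolding C_def by algebra
    also have "\<dots> \<le> 8 * C * (?T - C - A)"
      using C AC T16 by (intro mult_left_mono) auto
    finally have disc: "B\<^sup>2 \<le> 8 * C * (?T - C - A)" .
    have "A + C \<le> ?T" using AC T16 t by linarith
    with quadratic_bound_disc[OF A(1) B(1) le end1 _ mid disc, of x'] x show ?thesis
      unfolding x'(1) by (simp add: u_def)
  qed
  ultimately show ?thesis by linarith
qed

section \<open>The Schur algorithm\<close>

lemma holomorphic_has_fps_expansion_disc:
  "f holomorphic_on ball 0 1 \<Longrightarrow> f has_fps_expansion fps_expansion f 0"
  by (rule has_fps_expansion_fps_expansion[of "ball 0 1"]) auto

lemma fps_eq_if_eventually_eq:
  fixes f g :: "complex \<Rightarrow> complex"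
  assumes "f has_fps_expansion F" "g has_fps_expansion G" "\<forall>\<^sub>F z in nhds 0. f z = g z"
  shows "F = G"
proof -
  have "g has_fps_expansion F"
    using assms(1,3) has_fps_expansion_cong by blast
  then show ?thesis
    using assms(2) by (rule fps_expansion_unique_complex)
qed

lemma fps_eq_if_eq_on_disc:
  fixes f g :: "complex \<Rightarrow> complex"
  assumes "f has_fps_expansion F" "g has_fps_expansion G" "\<And>z. z \<in> ball 0 1 \<Longrightarrow> f z = g z"
  shows "F = G"
proof (rule fps_eq_if_eventually_eq[OF assms(1,2)])
  have "\<forall>\<^sub>F z in nhds 0. z \<in> ball (0::complex) 1"
    by (intro eventually_nhds_in_open) auto
  then show "\<forall>\<^sub>F z in nhds 0. f z = g z"
    by eventually_elim (rule assms(3))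
qed

text \<open>Schwarz's lemma for \<open>z * \<phi> z\<close>: divide by \<open>z\<close> away from
  the origin; at the origin \<open>\<phi> 0\<close> is the derivative of the product.\<close>

lemma schwarz_quotient:
  assumes hol: "\<phi> holomorphic_on ball 0 1"
    and less: "\<And>z. z \<in> ball 0 1 \<Longrightarrow> norm (z * \<phi> z) < 1" and z: "z \<in> ball 0 1"
  shows "norm (\<phi> z) \<le> 1"
proof -
  define w where "w = (\<lambda>z. z * \<phi> z)"
  have holw: "w holomorphic_on ball 0 1"
    unfolding w_def using hol by (intro holomorphic_intros)
  have w: "w 0 = 0" "\<And>z. norm z < 1 \<Longrightarrow> norm (w z) < 1"
    using less by (auto simp: w_def)
  show ?thesis
  proof (cases "z = 0")
    case True
    have "(\<phi> has_field_derivative deriv \<phi> 0) (at 0)"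
      using hol by (intro holomorphic_derivI[of _ "ball 0 1"]) auto
    then have "(w has_field_derivative \<phi> 0) (at 0)"
      unfolding w_def by (auto intro!: derivative_eq_intros)
    then have "deriv w 0 = \<phi> 0" by (rule DERIV_imp_deriv)
    then show ?thesis
      using Schwarz_Lemma(2)[OF holw w, of 0] True by simp
  next
    case False
    then show ?thesis
      using Schwarz_Lemma(1)[OF holw w, of z] z by (simp add: w_def norm_mult)
  qed
qed

text \<open>The bound is not strict, so unimodular constants belong to the class and Schur steps
  never leave it.\<close>

definition schur_class :: "(complex \<Rightarrow> complex) set" where
  "schur_class = {\<phi>. \<phi> holomorphic_on ball 0 1 \<and> (\<forall>z\<in>ball 0 1. norm (\<phi> z) \<le> 1)}"

text \<open>The disk automorphism sending \<open>\<phi> 0\<close> to 0, composed with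
  \<open>\<phi>\<close>, vanishes at 0 and hence is \<open>z * \<eta> z\<close> with
  \<open>\<eta>\<close> bounded by Schwarz. Inverting the automorphism and clearing the denominator
  gives an identity that passes directly to power series.\<close>

lemma schur_step:
  assumes "\<phi> \<in> schur_class"
  obtains \<eta> where "\<eta> \<in> schur_class"
    "\<And>z. z \<in> ball 0 1 \<Longrightarrow> \<phi> z * (1 + cnj (\<phi> 0) * (z * \<eta> z)) = \<phi> 0 + z * \<eta> z"
proof (cases "\<exists>\<xi>\<in>ball 0 1. norm (\<phi> \<xi>) = 1")
  have hol: "\<phi> holomorphic_on ball 0 1" and le: "\<And>z. z \<in> ball 0 1 \<Longrightarrow> norm (\<phi> z) \<le> 1"
    using assms by (auto simp: schur_class_def)
  case True
  then obtain \<xi> where \<xi>: "\<xi> \<in> ball 0 1" "norm (\<phi> \<xi>) = 1" by blast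
  \<comment> \<open>The automorphism degenerates when \<open>norm (\<phi> 0) = 1\<close>. In this
    case the maximum principle makes \<open>\<phi>\<close> constant and \<open>\<eta> = 0\<close>
    serves.\<close>
  have "\<phi> constant_on ball 0 1"
    using hol by (rule maximum_modulus_principle[where U = "ball 0 1" and \<xi> = \<xi>]) (use \<xi> le in auto)
  then obtain c where "\<And>z. z \<in> ball 0 1 \<Longrightarrow> \<phi> z = c"
    by (auto simp: constant_on_def)
  then show thesis
    by (intro that[of "\<lambda>_. 0"]) (auto simp: schur_class_def)
next
  have hol: "\<phi> holomorphic_on ball 0 1" and le: "\<And>z. z \<in> ball 0 1 \<Longrightarrow> norm (\<phi> z) \<le> 1"
    using assms by (auto simp: schur_class_def)
  case False
  then have less: "norm (\<phi> z) < 1" if "z \<in> ball 0 1" for z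
    using le[OF that] that by force
  define b where "b = \<phi> 0"
  have b: "norm b < 1" using less by (simp add: b_def)
  have nz: "1 - cnj b * w \<noteq> 0" if "norm w < 1" for w
  proof
    assume "1 - cnj b * w = 0"
    then have "norm b * norm w = 1"
      by (metis complex_mod_cnj eq_iff_diff_eq_0 norm_mult norm_one)
    moreover have "norm b * norm w < 1"
      using b that mult_left_le[of "norm w" "norm b"] by simp
    ultimately show False by simp
  qed
  define \<psi> where "\<psi> = (\<lambda>z. (\<phi> z - b) / (1 - cnj b * \<phi> z))"
  have "\<psi> holomorphic_on ball 0 1"
    unfolding \<psi>_def using hol nz less by (intro holomorphic_intros) auto
  moreover have "\<psi> 0 = 0" by (simp add: \<psi>_def b_def)
  ultimately obtain \<eta> where \<eta>: "\<eta> holomorphic_on ball 0 1" "\<And>z. norm z < 1 \<Longrightarrow> \<psi> z = z * \<eta> z"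
    by (rule Schwarz3) blast
  have "norm (\<psi> z) < 1" if "z \<in> ball 0 1" for z
  proof -
    have "norm (\<phi> z - b) < norm (1 - cnj b * \<phi> z)"
    proof (rule power2_less_imp_less)
      have "0 < (1 - (norm b)\<^sup>2) * (1 - (norm (\<phi> z))\<^sup>2)"
        using b less[OF that] by (simp add: abs_square_less_1)
      also have "\<dots> = (norm (1 - cnj b * \<phi> z))\<^sup>2 - (norm (\<phi> z - b))\<^sup>2"
        unfolding cmod_power2 by (simp add: algebra_simps power2_eq_square)
      finally show "(norm (\<phi> z - b))\<^sup>2 < (norm (1 - cnj b * \<phi> z))\<^sup>2" by simp
    qed simp
    then show ?thesis
      using nz[OF less[OF that]] by (simp add: \<psi>_def norm_divide)
  qed
  then have "norm (\<eta> z) \<le> 1" if "z \<in> ball 0 1" for z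
    using schwarz_quotient[OF \<eta>(1) _ that] \<eta>(2) by simp
  moreover have "\<phi> z * (1 + cnj b * (z * \<eta> z)) = b + z * \<eta> z" if "z \<in> ball 0 1" for z
  proof -
    have "\<phi> z - b = z * \<eta> z * (1 - cnj b * \<phi> z)"
      using \<eta>(2)[of z] that nz[OF less[OF that]] by (simp add: \<psi>_def field_simps)
    then show ?thesis by (simp add: algebra_simps)
  qed
  ultimately show thesis
    using \<eta>(1) by (intro that[of \<eta>]) (auto simp: b_def schur_class_def)
qed

lemma schur_step_fps:
  assumes "\<phi> \<in> schur_class"
  obtains \<eta> where "\<eta> \<in> schur_class"
    "fps_expansion \<phi> 0 * (1 + fps_const (cnj (\<phi> 0)) * (fps_X * fps_expansion \<eta> 0))
      = fps_const (\<phi> 0) + fps_X * fps_expansion \<eta> 0"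
proof -
  obtain \<eta> where \<eta>: "\<eta> \<in> schur_class"
    "\<And>z. z \<in> ball 0 1 \<Longrightarrow> \<phi> z * (1 + cnj (\<phi> 0) * (z * \<eta> z)) = \<phi> 0 + z * \<eta> z"
    using schur_step[OF assms] by blast
  have P: "\<phi> has_fps_expansion fps_expansion \<phi> 0" and Q: "\<eta> has_fps_expansion fps_expansion \<eta> 0"
    using assms \<eta>(1) by (auto simp: schur_class_def intro: holomorphic_has_fps_expansion_disc)
  have "fps_expansion \<phi> 0 * (1 + fps_const (cnj (\<phi> 0)) * (fps_X * fps_expansion \<eta> 0))
      = fps_const (\<phi> 0) + fps_X * fps_expansion \<eta> 0"
  proof (rule fps_eq_if_eq_on_disc[OF _ _ \<eta>(2)])
    show "(\<lambda>z. \<phi> z * (1 + cnj (\<phi> 0) * (z * \<eta> z))) has_fps_expansion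
        fps_expansion \<phi> 0 * (1 + fps_const (cnj (\<phi> 0)) * (fps_X * fps_expansion \<eta> 0))"
      by (intro fps_expansion_intros P Q)
    show "(\<lambda>z. \<phi> 0 + z * \<eta> z) has_fps_expansion fps_const (\<phi> 0) + fps_X * fps_expansion \<eta> 0"
      by (intro fps_expansion_intros Q)
  qed
  with \<eta>(1) show thesis by (rule that)
qed

lemma fps_nth_expansion_0 [simp]: "fps_nth (fps_expansion f 0) 0 = f 0"
  by (simp add: fps_expansion_def)

text \<open>Two Schur steps: \<open>x\<close> and \<open>y\<close> are the values at 0 of the first
  and second Schur transforms \<open>\<eta>\<close> and \<open>\<omega>\<close>.\<close>

lemma schur_coeffs:
  assumes "\<phi> \<in> schur_class"
  obtains x y :: complex where "norm x \<le> 1" "norm y \<le> 1"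
    "fps_nth (fps_expansion \<phi> 0) 1 = (1 - (norm (\<phi> 0))\<^sup>2) * x"
    "fps_nth (fps_expansion \<phi> 0) 2
      = (1 - (norm (\<phi> 0))\<^sup>2) * ((1 - (norm x)\<^sup>2) * y - cnj (\<phi> 0) * x\<^sup>2)"
proof -
  obtain \<eta> where \<eta>: "\<eta> \<in> schur_class"
    and eq1: "fps_expansion \<phi> 0 * (1 + fps_const (cnj (\<phi> 0)) * (fps_X * fps_expansion \<eta> 0))
      = fps_const (\<phi> 0) + fps_X * fps_expansion \<eta> 0"
    using schur_step_fps[OF assms] by blast
  obtain \<omega> where \<omega>: "\<omega> \<in> schur_class"
    and eq2: "fps_expansion \<eta> 0 * (1 + fps_const (cnj (\<eta> 0)) * (fps_X * fps_expansion \<omega> 0))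
      = fps_const (\<eta> 0) + fps_X * fps_expansion \<omega> 0"
    using schur_step_fps[OF \<eta>] by blast
  define P Q where "P = fps_expansion \<phi> 0" and "Q = fps_expansion \<eta> 0"
  note sum_simps = fps_mult_nth sum.atLeast_Suc_atMost numeral_2_eq_2
  have sq: "z * cnj z = (complex_of_real (norm z))\<^sup>2" for z
    using complex_norm_square[of z] by simp
  have Q1: "fps_nth Q 1 + \<eta> 0 * cnj (\<eta> 0) * \<omega> 0 = \<omega> 0"
    using arg_cong[OF eq2, of "\<lambda>F. fps_nth F 1"]
    by (simp add: Q_def sum_simps algebra_simps)
  have P1: "fps_nth P 1 + \<phi> 0 * cnj (\<phi> 0) * \<eta> 0 = \<eta> 0"
    using arg_cong[OF eq1, of "\<lambda>F. fps_nth F 1"]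
    by (simp add: P_def sum_simps algebra_simps)
  have P2: "fps_nth P 2 + fps_nth P 1 * cnj (\<phi> 0) * \<eta> 0 + \<phi> 0 * cnj (\<phi> 0) * fps_nth Q 1 = fps_nth Q 1"
    using arg_cong[OF eq1, of "\<lambda>F. fps_nth F 2"]
    by (simp add: P_def Q_def sum_simps algebra_simps)
  show thesis
  proof (rule that[of "\<eta> 0" "\<omega> 0"])
    show "norm (\<eta> 0) \<le> 1" "norm (\<omega> 0) \<le> 1"
      using \<eta> \<omega> by (auto simp: schur_class_def)
    have p1: "fps_nth P 1 = (1 - \<phi> 0 * cnj (\<phi> 0)) * \<eta> 0"
      using P1 by (simp add: algebra_simps eq_diff_eq)
    then show "fps_nth (fps_expansion \<phi> 0) 1 = (1 - (norm (\<phi> 0))\<^sup>2) * \<eta> 0"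
      by (simp add: P_def sq)
    have q1: "fps_nth Q 1 = (1 - \<eta> 0 * cnj (\<eta> 0)) * \<omega> 0"
      using Q1 by (simp add: algebra_simps eq_diff_eq)
    have "fps_nth P 2 = (1 - \<phi> 0 * cnj (\<phi> 0)) * (fps_nth Q 1 - cnj (\<phi> 0) * (\<eta> 0)\<^sup>2)"
      using P2 unfolding p1 by (simp add: algebra_simps power2_eq_square eq_diff_eq)
    then show "fps_nth (fps_expansion \<phi> 0) 2
        = (1 - (norm (\<phi> 0))\<^sup>2) * ((1 - (norm (\<eta> 0))\<^sup>2) * \<omega> 0 - cnj (\<phi> 0) * (\<eta> 0)\<^sup>2)"
      unfolding q1 by (simp add: P_def sq)
  qed
qed

section \<open>The Hankel determinant\<close>

text \<open>Differentiating \<open>f z / z = exp (log_quot f z)\<close> gives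
  \<open>G' = G * L'\<close> for the power series, which determines the coefficients of
  \<open>L\<close> recursively.\<close>

lemma hankel_log_2_1_eq:
  assumes f: "f \<in> class_A"
  defines "a \<equiv> fps_nth (fps_expansion f 0)"
  shows "hankel_log_2_1 f = (a 2 * a 4 - (a 3)\<^sup>2 + (a 2) ^ 4 / 12) / 4"
proof -
  have f': "f holomorphic_on ball 0 1" "f 0 = 0" "deriv f 0 = 1"
    using f by (auto simp: class_A_iff)
  \<comment> \<open>The value 1 fills the removable singularity and makes
    \<open>Ln (g 0) = 0\<close>, matching \<open>log_quot\<close> at 0 too.\<close>
  define g where "g = (\<lambda>z. if z = 0 then 1 else f z / z)"
  have holg: "g holomorphic_on ball 0 1"
    using pole_theorem_open_0[OF f'(1), of 0 g] f' by (simp add: g_def)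
  then have ang: "g analytic_on {0}"
    by (meson analytic_at centre_in_ball open_ball zero_less_one)
  have log: "log_quot f = (\<lambda>z. Ln (g z))"
    by (auto simp: log_quot_def g_def)
  have anl: "(\<lambda>z. Ln (g z)) analytic_on {0}"
    using ang by (intro analytic_intros) (auto simp: g_def)
  define F G L where "F = fps_expansion f 0" and "G = fps_expansion g 0"
    and "L = fps_expansion (log_quot f) 0"
  have F: "f has_fps_expansion F" and G: "g has_fps_expansion G"
    unfolding F_def G_def using f' holg by (auto intro: holomorphic_has_fps_expansion_disc)
  have L: "log_quot f has_fps_expansion L"
    unfolding L_def log using anl by (rule analytic_at_imp_has_fps_expansion_0)
  have L0: "fps_nth L 0 = 0"
    by (simp add: L_def log_quot_def)
  have "(\<lambda>z. z * g z) has_fps_expansion fps_X * G"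
    by (intro fps_expansion_intros G)
  then have FG: "F = fps_X * G"
    by (rule fps_eq_if_eq_on_disc[OF F]) (simp add: g_def f')
  have nz: "\<forall>\<^sub>F z in nhds 0. g z \<noteq> 0"
  proof -
    have "isCont g 0"
      using ang by (simp add: analytic_at_imp_isCont)
    then have "(g \<longlongrightarrow> 1) (nhds 0)"
      using tendsto_at_iff_tendsto_nhds[of g 0] by (simp add: isCont_def g_def)
    then show ?thesis
      by (rule tendsto_imp_eventually_ne) simp
  qed
  have "(exp \<circ> log_quot f) has_fps_expansion (fps_exp 1 oo L)"
    using L0 by (intro has_fps_expansion_compose L) (auto intro: fps_expansion_intros)
  then have GL: "G = fps_exp 1 oo L"
    by (rule fps_eq_if_eventually_eq[OF G])
      (use nz in \<open>auto simp: log elim: eventually_mono\<close>)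
  then have GL': "fps_deriv G = G * fps_deriv L"
    using L0 by (simp add: fps_compose_deriv)
  have G0: "fps_nth G 0 = 1" by (simp add: G_def g_def)
  \<comment> \<open>Dividing by \<open>z\<close> shifts the index by one.\<close>
  have a: "a 2 = fps_nth G 1" "a 3 = fps_nth G 2" "a 4 = fps_nth G 3"
    by (simp_all add: a_def FG flip: F_def)
  note sum_simps = fps_mult_nth sum.atLeast_Suc_atMost numeral_2_eq_2 numeral_3_eq_3
  have e1: "fps_nth G 1 = fps_nth L 1"
    using arg_cong[OF GL', of "\<lambda>F. fps_nth F 0"] G0 by simp
  have e2: "2 * fps_nth G 2 = 2 * fps_nth L 2 + fps_nth G 1 * fps_nth L 1"
    using arg_cong[OF GL', of "\<lambda>F. fps_nth F 1"] G0 by (simp add: sum_simps)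
  have e3: "3 * fps_nth G 3 = 3 * fps_nth L 3 + 2 * fps_nth G 1 * fps_nth L 2 + fps_nth G 2 * fps_nth L 1"
    using arg_cong[OF GL', of "\<lambda>F. fps_nth F 2"] G0 by (simp add: sum_simps algebra_simps)
  have l1: "fps_nth L 1 = a 2"
    using e1 a by simp
  have l2: "fps_nth L 2 = a 3 - (a 2)\<^sup>2 / 2"
    using e1 e2 by (simp add: a field_simps power2_eq_square)
  have "3 * fps_nth L 3 = 3 * a 4 - 3 * (a 2 * a 3) + (a 2) ^ 3"
    using e3 e1 l2 by (simp add: a algebra_simps power2_eq_square power3_eq_cube)
  then have l3: "fps_nth L 3 = a 4 - a 2 * a 3 + (a 2) ^ 3 / 3"
    by (simp add: field_simps)
  have "hankel_log_2_1 f = fps_nth L 1 * fps_nth L 3 / 4 - (fps_nth L 2)\<^sup>2 / 4"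
    by (simp add: hankel_log_2_1_def log_coeff_def L_def power_divide)
  also have "\<dots> = (a 2 * a 4 - (a 3)\<^sup>2 + (a 2) ^ 4 / 12) / 4"
    unfolding l1 l2 l3 by (simp add: field_simps power2_eq_square power3_eq_cube eval_nat_numeral)
  finally show ?thesis .
qed

text \<open>The differential equation gives \<open>a 2\<close>, \<open>a 3\<close>,
  \<open>a 4\<close> recursively in terms of \<open>b\<close>. The constant is
  \<open>2304 = 4 * 576\<close>, where 576 clears the denominators of \<open>a 2 * a 4\<close>,
  \<open>(a 3)\<^sup>2\<close> and \<open>(a 2) ^ 4 / 12\<close>.\<close>

lemma hankel_log_2_1_ode:
  fixes \<nu> :: real and \<phi> :: "complex \<Rightarrow> complex" and b :: "nat \<Rightarrow> complex"
  assumes f: "f \<in> class_A" and hol: "\<phi> holomorphic_on ball 0 1"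
    and ode: "\<And>z. z \<in> ball 0 1 \<Longrightarrow>
      deriv (deriv f) z * (1 - z * \<phi> z) = - of_real \<nu> * (\<phi> z * deriv f z)"
  defines "b \<equiv> fps_nth (fps_expansion \<phi> 0)"
  shows "hankel_log_2_1 f = \<nu>\<^sup>2 / 2304 * (24 * b 0 * b 2 - 16 * (b 1)\<^sup>2
      + (16 - 4 * \<nu>) * (b 0)\<^sup>2 * b 1 + (8 - 4 * \<nu> - \<nu>\<^sup>2) * b 0 ^ 4)"
proof -
  have f': "f holomorphic_on ball 0 1" "f 0 = 0" "deriv f 0 = 1"
    using f by (auto simp: class_A_iff)
  define F P where "F = fps_expansion f 0" and "P = fps_expansion \<phi> 0"
  have F: "f has_fps_expansion F" and P: "\<phi> has_fps_expansion P"
    unfolding F_def P_def using f' hol by (auto intro: holomorphic_has_fps_expansion_disc)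
  have eq: "fps_deriv (fps_deriv F) * (1 - fps_X * P) = fps_const (- of_real \<nu>) * (P * fps_deriv F)"
  proof (rule fps_eq_if_eq_on_disc[OF _ _ ode])
    show "(\<lambda>z. deriv (deriv f) z * (1 - z * \<phi> z)) has_fps_expansion
        fps_deriv (fps_deriv F) * (1 - fps_X * P)"
      by (intro has_fps_expansion_mult has_fps_expansion_diff has_fps_expansion_deriv
          has_fps_expansion_1 has_fps_expansion_fps_X F P)
    show "(\<lambda>z. - of_real \<nu> * (\<phi> z * deriv f z)) has_fps_expansion
        fps_const (- of_real \<nu>) * (P * fps_deriv F)"
      using has_fps_expansion_cmult_left[OF has_fps_expansion_mult[OF P has_fps_expansion_deriv[OF F]],
          of "- of_real \<nu>"] by simp
  qed
  have F1: "fps_nth F 1 = 1"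
    using f' by (simp add: F_def fps_expansion_def)
  define v where "v = complex_of_real \<nu>"
  define a where "a = fps_nth F"
  note sum_simps = fps_mult_nth sum.atLeast_Suc_atMost numeral_2_eq_2 numeral_3_eq_3
  have a2: "a 2 = - v * b 0 / 2"
    using arg_cong[OF eq, of "\<lambda>F. fps_nth F 0"] F1
    by (simp add: a_def b_def v_def P_def numeral_2_eq_2 field_simps)
  have a3: "6 * a 3 = 2 * a 2 * b 0 - v * (b 1 + 2 * a 2 * b 0)"
    using arg_cong[OF eq, of "\<lambda>F. fps_nth F 1"] F1
    by (simp add: a_def b_def v_def P_def sum_simps algebra_simps)
  have a4: "12 * a 4 = 6 * a 3 * b 0 + 2 * a 2 * b 1 - v * (b 2 + 2 * a 2 * b 1 + 3 * a 3 * b 0)"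
    using arg_cong[OF eq, of "\<lambda>F. fps_nth F 2"] F1
    by (simp add: a_def b_def v_def P_def sum_simps eval_nat_numeral algebra_simps)
  have "hankel_log_2_1 f = (a 2 * a 4 - (a 3)\<^sup>2 + (a 2) ^ 4 / 12) / 4"
    using hankel_log_2_1_eq[OF f] by (simp add: a_def F_def)
  also have "\<dots> = v\<^sup>2 / 2304 * (24 * b 0 * b 2 - 16 * (b 1)\<^sup>2
      + (16 - 4 * v) * (b 0)\<^sup>2 * b 1 + (8 - 4 * v - v\<^sup>2) * b 0 ^ 4)"
  proof -
    have a3': "a 3 = (2 * a 2 * b 0 - v * (b 1 + 2 * a 2 * b 0)) / 6"
      using a3 by (simp add: field_simps)
    have a4': "a 4 = (6 * a 3 * b 0 + 2 * a 2 * b 1 - v * (b 2 + 2 * a 2 * b 1 + 3 * a 3 * b 0)) / 12"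
      using a4 by (simp add: field_simps)
    show ?thesis
      unfolding a4' a3' a2 by (simp add: field_simps) algebra
  qed
  finally show ?thesis
    by (simp add: v_def)
qed

section \<open>Correspondence between \<open>class_G \<nu>\<close> and the Schur class\<close>

text \<open>The line \<open>Re h = r / 2\<close> is the perpendicular bisector of 0 and
  \<open>r\<close>. Thus the half-plane condition of \<open>class_G\<close> says that
  \<open>h / (h - r)\<close> lies in the unit disk.\<close>

lemma norm_less_norm_diff_of_real_iff:
  assumes "0 < r"
  shows "norm h < norm (h - of_real r) \<longleftrightarrow> Re h < r / 2"
proof -
  have "norm h < norm (h - of_real r) \<longleftrightarrow> (norm h)\<^sup>2 < (norm (h - of_real r))\<^sup>2"
    by (meson norm_ge_zero power2_less_imp_less power_strict_mono zero_less_numeral)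
  also have "\<dots> \<longleftrightarrow> 0 < r * (r - 2 * Re h)"
    unfolding cmod_power2 by (simp add: algebra_simps power2_eq_square)
  also have "\<dots> \<longleftrightarrow> Re h < r / 2"
    using assms by (simp add: zero_less_mult_iff field_simps)
  finally show ?thesis .
qed

text \<open>With \<open>h = z f'' / f'\<close> the function \<open>h / (h - \<nu>)\<close> maps the
  disk into itself and vanishes at 0; \<open>\<phi>\<close> is its quotient by \<open>z\<close>,
  written through \<open>d\<close> so that no division by \<open>z\<close> occurs.\<close>

lemma class_G_imp_schur:
  assumes "0 < \<nu>" and f: "f \<in> class_G \<nu>"
  obtains \<phi> where "\<phi> \<in> schur_class"
    "\<And>z. z \<in> ball 0 1 \<Longrightarrow>
      deriv (deriv f) z * (1 - z * \<phi> z) = - of_real \<nu> * (\<phi> z * deriv f z)"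
proof -
  have hol: "f holomorphic_on ball 0 1" and nz: "\<And>z. z \<in> ball 0 1 \<Longrightarrow> deriv f z \<noteq> 0"
    and Re: "\<And>z. z \<in> ball 0 1 \<Longrightarrow> Re (1 + z * deriv (deriv f) z / deriv f z) < 1 + \<nu> / 2"
    using f by (auto simp: class_G_def class_LU_def class_A_iff)
  define d where "d = (\<lambda>z. deriv (deriv f) z / deriv f z)"
  define \<phi> where "\<phi> = (\<lambda>z. d z / (z * d z - of_real \<nu>))"
  have less: "norm (z * d z) < norm (z * d z - of_real \<nu>)" if "z \<in> ball 0 1" for z
    using Re[OF that] assms(1) by (simp add: norm_less_norm_diff_of_real_iff d_def)
  have nz': "z * d z - of_real \<nu> \<noteq> 0" if "z \<in> ball 0 1" for z
    using less[OF that] by auto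
  have "d holomorphic_on ball 0 1"
    unfolding d_def using hol nz by (intro holomorphic_intros holomorphic_deriv) auto
  then have hol\<phi>: "\<phi> holomorphic_on ball 0 1"
    unfolding \<phi>_def using nz' by (intro holomorphic_intros) auto
  have "norm (z * \<phi> z) < 1" if "z \<in> ball 0 1" for z
  proof -
    have "z * \<phi> z = z * d z / (z * d z - of_real \<nu>)"
      by (simp add: \<phi>_def)
    then show ?thesis
      using less[OF that] nz'[OF that] by (simp only: norm_divide) simp
  qed
  then have "\<phi> \<in> schur_class"
    using schwarz_quotient[OF hol\<phi>] hol\<phi> by (auto simp: schur_class_def)
  moreover have "deriv (deriv f) z * (1 - z * \<phi> z) = - of_real \<nu> * (\<phi> z * deriv f z)"
    if "z \<in> ball 0 1" for z
  proof -
    have "deriv (deriv f) z = d z * deriv f z"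
      using nz[OF that] by (simp add: d_def)
    moreover have "\<phi> z * (z * d z - of_real \<nu>) = d z"
      using nz'[OF that] by (simp add: \<phi>_def)
    ultimately show ?thesis by algebra
  qed
  ultimately show thesis by (rule that)
qed

lemma primitive_on_disc:
  assumes "g holomorphic_on ball 0 1"
  shows "\<exists>G. \<forall>z\<in>ball 0 1. (G has_field_derivative g z) (at z)"
proof -
  obtain G where "\<And>z. z \<in> ball 0 1 \<Longrightarrow> (G has_field_derivative g z) (at z within ball 0 1)"
    by (rule holomorphic_convex_primitive'[OF _ _ assms]) auto
  then have "(G has_field_derivative g z) (at z)" if "z \<in> ball 0 1" for z
    using that at_within_open[OF that] by fastforce
  then show ?thesis by blast
qed

text \<open>The equation is \<open>f'' / f' = - \<nu> * g\<close>, so \<open>f\<close> arises by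
  integrating, exponentiating and integrating again, with constants chosen so that
  \<open>f 0 = 0\<close> and \<open>f' 0 = 1\<close>.\<close>

lemma schur_imp_class_G:
  assumes \<nu>: "0 < \<nu>" and \<phi>: "\<phi> \<in> schur_class"
  obtains f where "f \<in> class_G \<nu>"
    "\<And>z. z \<in> ball 0 1 \<Longrightarrow>
      deriv (deriv f) z * (1 - z * \<phi> z) = - of_real \<nu> * (\<phi> z * deriv f z)"
proof -
  have less: "norm (z * \<phi> z) < 1" if "z \<in> ball 0 1" for z
  proof -
    have "norm (z * \<phi> z) \<le> norm z"
      using \<phi> that by (simp add: schur_class_def norm_mult mult_left_le)
    then show ?thesis using that by simp
  qed
  have nz: "1 - z * \<phi> z \<noteq> 0" if "z \<in> ball 0 1" for z
    using less[OF that] by auto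
  define g where "g = (\<lambda>z. \<phi> z / (1 - z * \<phi> z))"
  have "g holomorphic_on ball 0 1"
    unfolding g_def using \<phi> nz by (intro holomorphic_intros) (auto simp: schur_class_def)
  then obtain G where G: "\<And>z. z \<in> ball 0 1 \<Longrightarrow> (G has_field_derivative g z) (at z)"
    using primitive_on_disc by blast
  define h where "h = (\<lambda>z. exp (- of_real \<nu> * (G z - G 0)))"
  have h': "(h has_field_derivative - of_real \<nu> * g z * h z) (at z)" if "z \<in> ball 0 1" for z
    unfolding h_def by (auto intro!: derivative_eq_intros G that)
  then have "h holomorphic_on ball 0 1"
    unfolding holomorphic_on_open[OF open_ball] by blast
  then obtain H where H: "\<And>z. z \<in> ball 0 1 \<Longrightarrow> (H has_field_derivative h z) (at z)"
    using primitive_on_disc by blast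
  define f where "f = (\<lambda>z. H z - H 0)"
  have f': "(f has_field_derivative h z) (at z)" if "z \<in> ball 0 1" for z
    unfolding f_def by (auto intro!: derivative_eq_intros H that)
  have df: "deriv f z = h z" if "z \<in> ball 0 1" for z
    using f'[OF that] by (rule DERIV_imp_deriv)
  have ddf: "deriv (deriv f) z = - of_real \<nu> * g z * h z" if "z \<in> ball 0 1" for z
  proof -
    \<comment> \<open>\<open>deriv f\<close> agrees with \<open>h\<close> only on the disk, so
      differentiating again needs agreement near \<open>z\<close>.\<close>
    have "\<forall>\<^sub>F w in nhds z. w \<in> ball 0 1"
      using that by (intro eventually_nhds_in_open) auto
    then have "deriv (deriv f) z = deriv h z"
      by (intro deriv_cong_ev) (auto elim: eventually_mono simp: df)
    then show ?thesis
      using DERIV_imp_deriv[OF h'[OF that]] by simp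
  qed
  have "f holomorphic_on ball 0 1"
    using f' unfolding holomorphic_on_open[OF open_ball] by blast
  then have "f \<in> class_A"
    using df[of 0] by (simp add: class_A_iff f_def h_def)
  moreover have "h z \<noteq> 0" for z
    by (simp add: h_def)
  moreover have "Re (1 + z * deriv (deriv f) z / deriv f z) < 1 + \<nu> / 2" if z: "z \<in> ball 0 1" for z
  proof -
    define v where "v = - of_real \<nu> * (z * g z)"
    \<comment> \<open>Here \<open>v\<close> is \<open>z f'' / f'\<close>, and
      \<open>z * \<phi> z\<close> is its image under the map to the disk.\<close>
    have "v = (v - of_real \<nu>) * (z * \<phi> z)"
      using nz[OF z] by (simp add: v_def g_def field_simps)
    then have v: "norm v = norm (v - of_real \<nu>) * norm (z * \<phi> z)"
      unfolding norm_mult[of "v - of_real \<nu>", symmetric] by (rule arg_cong)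
    have "v - of_real \<nu> \<noteq> 0"
    proof
      assume 0: "v - of_real \<nu> = 0"
      then have "norm v = 0" unfolding v by simp
      then show False using 0 \<nu> by simp
    qed
    then have "norm v < norm (v - of_real \<nu>)"
      unfolding v using less[OF z] by (simp add: mult_less_cancel_left2)
    then have "Re v < \<nu> / 2"
      using \<nu> by (simp only: norm_less_norm_diff_of_real_iff)
    moreover have "z * deriv (deriv f) z / deriv f z = v"
      using z \<open>h z \<noteq> 0\<close> by (simp add: ddf df v_def)
    ultimately show ?thesis by simp
  qed
  ultimately have "f \<in> class_G \<nu>"
    using df by (simp add: class_G_def class_LU_def)
  moreover have "deriv (deriv f) z * (1 - z * \<phi> z) = - of_real \<nu> * (\<phi> z * deriv f z)"
    if "z \<in> ball 0 1" for z
  proof -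
    have "g z * (1 - z * \<phi> z) = \<phi> z"
      using nz[OF that] by (simp add: g_def)
    moreover have "- of_real \<nu> * g z * h z * (1 - z * \<phi> z) = - of_real \<nu> * (g z * (1 - z * \<phi> z) * h z)"
      by (simp only: mult_ac)
    ultimately show ?thesis
      by (simp only: ddf[OF that] df[OF that])
  qed
  ultimately show thesis by (rule that)
qed

section \<open>The extremal function and the sharp bound\<close>

text \<open>This function has first Schur transform constantly -1, which realises the critical value
  \<open>x = -1\<close>.\<close>

lemma disk_automorphism_schur_coeffs:
  assumes "0 \<le> c" "c < 1"
  shows "(\<lambda>z. (of_real c - z) / (1 - of_real c * z)) \<in> schur_class" (is "?\<phi> \<in> _")
    and "fps_nth (fps_expansion (\<lambda>z. (of_real c - z) / (1 - of_real c * z)) 0) 1 = of_real (c\<^sup>2 - 1)"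
    and "fps_nth (fps_expansion (\<lambda>z. (of_real c - z) / (1 - of_real c * z)) 0) 2 = of_real (c * (c\<^sup>2 - 1))"
proof -
  have nz: "1 - of_real c * z \<noteq> 0" if "z \<in> ball 0 1" for z :: complex
  proof
    assume "1 - of_real c * z = 0"
    then have "of_real c * z = 1" by simp
    then have "norm (of_real c * z) = 1" by (simp only: norm_one)
    moreover have "norm (of_real c * z) \<le> c"
      using that assms by (simp add: norm_mult mult_left_le)
    ultimately show False using assms by simp
  qed
  have hol: "?\<phi> holomorphic_on ball 0 1"
    using nz by (intro holomorphic_intros) auto
  have "norm (?\<phi> z) \<le> 1" if z: "z \<in> ball 0 1" for z
  proof -
    have "norm (of_real c - z) \<le> norm (1 - of_real c * z)"
    proof (rule power2_le_imp_le)
      have "0 \<le> (1 - c\<^sup>2) * (1 - (norm z)\<^sup>2)"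
        using assms z by (intro mult_nonneg_nonneg) (auto simp: power_le_one)
      also have "\<dots> = (norm (1 - of_real c * z))\<^sup>2 - (norm (of_real c - z))\<^sup>2"
        unfolding cmod_power2 by (simp add: algebra_simps power2_eq_square)
      finally show "(norm (of_real c - z))\<^sup>2 \<le> (norm (1 - of_real c * z))\<^sup>2" by simp
    qed simp
    then show ?thesis
      using nz[OF z] by (simp add: norm_divide)
  qed
  then show "?\<phi> \<in> schur_class"
    using hol by (simp add: schur_class_def)
  define P where "P = fps_expansion ?\<phi> 0"
  have "P * (1 - fps_const (of_real c) * fps_X) = fps_const (of_real c) - fps_X"
  proof (rule fps_eq_if_eq_on_disc)
    show "(\<lambda>z. ?\<phi> z * (1 - of_real c * z)) has_fps_expansion P * (1 - fps_const (of_real c) * fps_X)"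
      unfolding P_def by (intro fps_expansion_intros holomorphic_has_fps_expansion_disc hol)
    show "(\<lambda>z. of_real c - z) has_fps_expansion fps_const (complex_of_real c) - fps_X"
      by (intro fps_expansion_intros)
  qed (use nz in simp)
  note eq = arg_cong[OF this, of "\<lambda>F. fps_nth F 1"] arg_cong[OF this, of "\<lambda>F. fps_nth F 2"]
  have P0: "fps_nth P 0 = of_real c" by (simp add: P_def)
  have P1: "fps_nth P 1 = of_real (c\<^sup>2 - 1)"
    using eq(1) P0 by (simp add: fps_mult_nth algebra_simps power2_eq_square)
  then show "fps_nth (fps_expansion ?\<phi> 0) 1 = of_real (c\<^sup>2 - 1)"
    by (simp add: P_def)
  have "fps_nth P 2 = of_real c * fps_nth P 1"
    using eq(2) P0
    by (simp add: fps_mult_nth sum.atLeast_Suc_atMost numeral_2_eq_2 algebra_simps)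
  then have "fps_nth P 2 = of_real (c * (c\<^sup>2 - 1))"
    unfolding P1 by simp
  then show "fps_nth (fps_expansion ?\<phi> 0) 2 = of_real (c * (c\<^sup>2 - 1))"
    by (simp add: P_def)
qed

theorem theorem3p4:
  fixes \<nu> :: real
  assumes "0 < \<nu>" and "\<nu> \<le> 1"
  shows "(\<forall>f\<in>class_G \<nu>. norm (hankel_log_2_1 f)
            \<le> \<nu>\<^sup>2 * (\<nu>\<^sup>2 + 12 * \<nu> - 44) / (192 * (\<nu>\<^sup>2 + 8 * \<nu> - 32)))
       \<and> (\<exists>f\<in>class_G \<nu>. norm (hankel_log_2_1 f)
            = \<nu>\<^sup>2 * (\<nu>\<^sup>2 + 12 * \<nu> - 44) / (192 * (\<nu>\<^sup>2 + 8 * \<nu> - 32)))"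
proof -
  define K T where "K = 32 - 8 * \<nu> - \<nu>\<^sup>2" and "T = 12 * (44 - 12 * \<nu> - \<nu>\<^sup>2) / K"
  have "\<nu>\<^sup>2 \<le> 1" using assms by (simp add: power_le_one)
  then have K: "4 < K" "0 \<le> T"
    using assms by (auto simp: K_def T_def)
  \<comment> \<open>Numerator and denominator of the stated bound are both negative, so both signs
    are flipped; \<open>2304 = 12 * 192\<close>.\<close>
  have target: "\<nu>\<^sup>2 * (\<nu>\<^sup>2 + 12 * \<nu> - 44) / (192 * (\<nu>\<^sup>2 + 8 * \<nu> - 32)) = \<nu>\<^sup>2 / 2304 * T"
  proof -
    have "\<nu>\<^sup>2 + 12 * \<nu> - 44 = - (44 - 12 * \<nu> - \<nu>\<^sup>2)" "\<nu>\<^sup>2 + 8 * \<nu> - 32 = - K"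
      by (simp_all add: K_def)
    moreover have "\<nu>\<^sup>2 * - M / (192 * - K) = \<nu>\<^sup>2 / 2304 * (12 * M / K)" for M
      by simp
    ultimately show ?thesis
      unfolding T_def by (simp only:)
  qed
  have class_A: "f \<in> class_A" if "f \<in> class_G \<nu>" for f
    using that by (simp add: class_G_def class_LU_def)
  have "norm (hankel_log_2_1 f) \<le> \<nu>\<^sup>2 / 2304 * T" if f: "f \<in> class_G \<nu>" for f
  proof -
    obtain \<phi> where \<phi>: "\<phi> \<in> schur_class" and ode: "\<And>z. z \<in> ball 0 1 \<Longrightarrow>
        deriv (deriv f) z * (1 - z * \<phi> z) = - of_real \<nu> * (\<phi> z * deriv f z)"
      using class_G_imp_schur[OF assms(1) f] by blast
    obtain x y :: complex where xy: "norm x \<le> 1" "norm y \<le> 1"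
      and b1: "fps_nth (fps_expansion \<phi> 0) 1 = (1 - (norm (\<phi> 0))\<^sup>2) * x"
      and b2: "fps_nth (fps_expansion \<phi> 0) 2
        = (1 - (norm (\<phi> 0))\<^sup>2) * ((1 - (norm x)\<^sup>2) * y - cnj (\<phi> 0) * x\<^sup>2)"
      using schur_coeffs[OF \<phi>] by blast
    have hol: "\<phi> holomorphic_on ball 0 1" and b0: "norm (\<phi> 0) \<le> 1"
      using \<phi> by (auto simp: schur_class_def)
    define b where "b = fps_nth (fps_expansion \<phi> 0)"
    define E where "E = 24 * b 0 * b 2 - 16 * (b 1)\<^sup>2 + (16 - 4 * \<nu>) * (b 0)\<^sup>2 * b 1
      + (8 - 4 * \<nu> - \<nu>\<^sup>2) * b 0 ^ 4"
    have "hankel_log_2_1 f = of_real (\<nu>\<^sup>2 / 2304) * E"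
      unfolding E_def b_def by (rule hankel_log_2_1_ode[OF class_A[OF f] hol ode])
    then have "norm (hankel_log_2_1 f) = \<nu>\<^sup>2 / 2304 * norm E"
      by (simp only: norm_mult norm_of_real) simp
    also have "\<dots> \<le> \<nu>\<^sup>2 / 2304 * T"
      unfolding E_def b_def b1 b2 fps_nth_expansion_0 T_def K_def
      by (intro mult_left_mono hankel_functional_bound assms b0 xy) simp
    finally show ?thesis .
  qed
  moreover have "\<exists>f\<in>class_G \<nu>. norm (hankel_log_2_1 f) = \<nu>\<^sup>2 / 2304 * T"
  proof -
    \<comment> \<open>\<open>t\<close> maximises \<open>C + B - A\<close>, and \<open>c\<close> is
      the value of the extremal \<open>\<phi>\<close> at 0.\<close>
    define t c where "t = (4 - 2 * \<nu>) / K" and "c = sqrt t"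
    define \<phi> :: "complex \<Rightarrow> complex" where "\<phi> = (\<lambda>z. (of_real c - z) / (1 - of_real c * z))"
    have t: "0 \<le> t" "t < 1"
      using K assms by (auto simp: t_def)
    then have c: "0 \<le> c" "c < 1" "c\<^sup>2 = t" by (auto simp: c_def)
    note \<phi> = disk_automorphism_schur_coeffs[OF c(1,2), folded \<phi>_def]
    obtain f where f: "f \<in> class_G \<nu>" and ode: "\<And>z. z \<in> ball 0 1 \<Longrightarrow>
        deriv (deriv f) z * (1 - z * \<phi> z) = - of_real \<nu> * (\<phi> z * deriv f z)"
      using schur_imp_class_G[OF assms(1) \<phi>(1)] by blast
    have hol: "\<phi> holomorphic_on ball 0 1" and \<phi>0: "\<phi> 0 = of_real c"
      using \<phi>(1) by (auto simp: schur_class_def \<phi>_def)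
    from hankel_log_2_1_ode[OF class_A[OF f] hol ode]
    have "hankel_log_2_1 f = of_real (\<nu>\<^sup>2 / 2304 * (24 * c * (c * (c\<^sup>2 - 1)) - 16 * (c\<^sup>2 - 1)\<^sup>2
        + (16 - 4 * \<nu>) * c\<^sup>2 * (c\<^sup>2 - 1) + (8 - 4 * \<nu> - \<nu>\<^sup>2) * c ^ 4))"
      unfolding \<phi>(2,3) fps_nth_expansion_0 \<phi>0 by simp
    \<comment> \<open>At \<open>x = -1\<close> the functional equals \<open>- (C + B - A)\<close>,
      so the extremal determinant is negative.\<close>
    also have "24 * c * (c * (c\<^sup>2 - 1)) - 16 * (c\<^sup>2 - 1)\<^sup>2
        + (16 - 4 * \<nu>) * c\<^sup>2 * (c\<^sup>2 - 1) + (8 - 4 * \<nu> - \<nu>\<^sup>2) * c ^ 4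
        = - (16 + 2 * (4 - 2 * \<nu>) * t - K * t\<^sup>2)"
      unfolding c(3)[symmetric] K_def by algebra
    also have "16 + 2 * (4 - 2 * \<nu>) * t - K * t\<^sup>2 = 16 + (4 - 2 * \<nu>)\<^sup>2 / K"
      using K by (simp add: t_def field_simps power2_eq_square)
    also have "\<dots> = T"
      using K by (simp add: T_def field_simps) (simp add: K_def algebra_simps power2_eq_square)
    finally have "norm (hankel_log_2_1 f) = \<bar>\<nu>\<^sup>2 / 2304 * - T\<bar>"
      by (simp only: norm_of_real)
    then have "norm (hankel_log_2_1 f) = \<nu>\<^sup>2 / 2304 * T"
      using K by (simp add: abs_mult)
    with f show ?thesis by blast
  qed
  ultimately show ?thesis
    unfolding target by blast
qed

end
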